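(* Let $q$ be a prime power and let $m,\ell\ge1$ be integers with $\ell\mid m$, $m/\ell$ even and $\ell\ne\frac m2$. If $\frac12(m/\ell)$ is odd, then $\Gamma_{q,m}(\ell)$ is a strongly regular graph of Latin square type.
   Context: For a prime power $q$ and integers $m\ge1,\ell\ge0$, $S_{q,m}(\ell)=\{x^{q^\ell+1}:x\in\mathbb F_{q^m}^*\}$ and $\Gamma_{q,m}(\ell)$ is the Cayley graph on $\mathbb F_{q^m}$ with $x\sim y$ iff $y-x\in S_{q,m}(\ell)$. A strongly regular graph is of (pseudo-)Latin square type if its parameters $(v,k,e,d)$ (vertices, valency, common neighbours of adjacent pairs, common neighbours of non-adjacent pairs) are of the form $(n^2,\ t(n-1),\ n-2+(t-1)(t-2),\ t(t-1))$ for some positive integers $n,t$. *)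

theory Defs
  imports "HOL-Library.Cardinality" "HOL-Number_Theory.Prime_Powers" "Graph_Theory.Pair_Digraph"
begin

text \<open>
  A simple graph is a symmetric loop-free digraph, i.e. a member of the locale \<open>pair_graph\<close>.
  The field with \<open>q ^ m\<close> elements is a type \<open>'a :: {finite, field}\<close> with \<open>CARD('a) = q ^ m\<close>;
  \<open>m\<close> therefore is not an argument of \<open>connection_set\<close> and \<open>Gamma\<close>.
\<close>

definition connection_set :: "nat \<Rightarrow> nat \<Rightarrow> 'a :: field set" where
  "connection_set q l = {x ^ (q ^ l + 1) | x. x \<noteq> 0}"

definition cayley_graph :: "'a :: group_add set \<Rightarrow> 'a pair_pre_digraph" where
  "cayley_graph S = \<lparr> pverts = UNIV, parcs = {(x, y). y - x \<in> S} \<rparr>"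

definition Gamma :: "nat \<Rightarrow> nat \<Rightarrow> 'a :: field pair_pre_digraph" where
  "Gamma q l = cayley_graph (connection_set q l)"

definition common_neighbours :: "'a pair_pre_digraph \<Rightarrow> 'a \<Rightarrow> 'a \<Rightarrow> 'a set" where
  "common_neighbours G x y = {z \<in> pverts G. x \<rightarrow>\<^bsub>G\<^esub> z \<and> y \<rightarrow>\<^bsub>G\<^esub> z}"

text \<open>
  The bounds on \<open>k\<close> exclude, as usual, the edgeless and the complete graphs, for which \<open>e\<close>
  respectively \<open>d\<close> would be arbitrary.
\<close>

definition strongly_regular :: "'a pair_pre_digraph \<Rightarrow> nat \<Rightarrow> nat \<Rightarrow> nat \<Rightarrow> nat \<Rightarrow> bool" where
  "strongly_regular G v k e d \<longleftrightarrow>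
     pair_graph G \<and> card (pverts G) = v \<and> 0 < k \<and> k < v - 1 \<and>
     (\<forall>x \<in> pverts G. card {y \<in> pverts G. x \<rightarrow>\<^bsub>G\<^esub> y} = k) \<and>
     (\<forall>x \<in> pverts G. \<forall>y \<in> pverts G. x \<rightarrow>\<^bsub>G\<^esub> y \<longrightarrow> card (common_neighbours G x y) = e) \<and>
     (\<forall>x \<in> pverts G. \<forall>y \<in> pverts G. x \<noteq> y \<and> \<not> x \<rightarrow>\<^bsub>G\<^esub> y \<longrightarrow> card (common_neighbours G x y) = d)"

text \<open>
  The parameters are compared as integers since \<open>n - 2\<close> and \<open>t - 2\<close> may be negative.
\<close>

definition latin_square_type :: "'a pair_pre_digraph \<Rightarrow> bool" where
  "latin_square_type G \<longleftrightarrow>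
     (\<exists>v k e d. strongly_regular G v k e d \<and>
       (\<exists>n t :: int. n > 0 \<and> t > 0 \<and>
          int v = n ^ 2 \<and> int k = t * (n - 1) \<and>
          int e = n - 2 + (t - 1) * (t - 2) \<and> int d = t * (t - 1)))"

end

(* Let n = q^(m/2) be the order of the subfield F with n^2 = |K|. Since r = m/(2l) is odd,
   q^l + 1 divides n + 1, so F* lies in the subgroup S of (q^l + 1)-th powers, whose index is
   q^l + 1. Hence S together with 0 is a union of t = (n + 1)/(q^l + 1) lines through the origin
   of the affine plane K = F^2, and the graph is the Latin square graph of t parallel classes.
   The common neighbours are counted without naming the lines: for a line L = Fa, all translates
   b + L other than L meet S in the same number of points, because the multiples of
   b + L by F* partition the complement of L and S is invariant under F*. *)
theory Submission
  imports Defs "HOL-Computational_Algebra.Polynomial"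
begin

section \<open>Powers and roots of unity in finite fields\<close>

lemma card_power_eq_le:
  fixes c :: "'a :: idom"
  assumes "e > 0"
  shows "card {x. x ^ e = c} \<le> e"
proof -
  let ?p = "monom 1 e - [:c:]"
  \<comment> \<open>As \<open>e\<close> is positive, the constant term cannot cancel the leading
    one, even for \<open>e = 1\<close>.\<close>
  have deg: "degree ?p = e"
    using assms degree_add_eq_left[of "- [:c:]" "monom 1 e"] by (simp add: degree_monom_eq del: minus_pCons)
  with assms have "?p \<noteq> 0" by auto
  then have "card {x. poly ?p x = 0} \<le> degree ?p" by (rule card_poly_roots_bound)
  then show ?thesis by (simp add: deg poly_monom)
qed

text \<open>Multiplication by \<open>x\<close> permutes the nonzero elements, so scaling every
  factor leaves their product unchanged.\<close>

lemma finite_field_power_card_minus_1: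
  fixes x :: "'a :: {finite, field}"
  assumes "x \<noteq> 0"
  shows "x ^ (CARD('a) - 1) = 1"
proof -
  have "(\<Prod>y\<in>UNIV-{0}. x * y) = (\<Prod>y\<in>UNIV-{0}. y)"
    by (rule prod.reindex_bij_witness[of _ "\<lambda>y. y / x" "\<lambda>y. x * y"]) (use assms in auto)
  moreover have "(\<Prod>y\<in>UNIV-{0}. x * y) = x ^ (CARD('a) - 1) * \<Prod>(UNIV-{0})"
    by (simp add: prod.distrib)
  moreover have "\<Prod>(UNIV-{0::'a}) \<noteq> 0" by simp
  ultimately show ?thesis by (metis mult_cancel_right1)
qed

lemma one_less_card_field: "1 < CARD('a :: {finite, field})"
proof -
  have "card {0, 1 :: 'a} \<le> CARD('a)" by (rule card_mono) auto
  then show ?thesis by simp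
qed

text \<open>A squeeze that avoids cyclicity of the multiplicative group: \<open>d\<close>-th powers
  are among the at most \<open>e\<close> roots of unity, while fibres of size at most
  \<open>d\<close> force at least \<open>e\<close> powers.\<close>

lemma nonzero_powers_eq_roots_of_unity:
  fixes d e :: nat
  assumes de: "CARD('a :: {finite, field}) - 1 = d * e"
  shows "{x ^ d | x. x \<noteq> (0 :: 'a)} = {y. y ^ e = 1}"
    and "card {y :: 'a. y ^ e = 1} = e"
proof -
  let ?P = "{x ^ d | x. x \<noteq> (0 :: 'a)}" and ?R = "{y :: 'a. y ^ e = 1}"
  have "d * e > 0" unfolding de[symmetric] using one_less_card_field by simp
  then have "d > 0" "e > 0" by simp_all
  have sub: "?P \<subseteq> ?R"
    using finite_field_power_card_minus_1[where 'a = 'a, unfolded de]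
    by (auto simp flip: power_mult)
  have "UNIV - {0} \<subseteq> (\<Union>y\<in>?P. {x :: 'a. x ^ d = y})" by auto
  then have "card (UNIV - {0 :: 'a}) \<le> card (\<Union>y\<in>?P. {x :: 'a. x ^ d = y})"
    by (intro card_mono) auto
  also have "\<dots> \<le> (\<Sum>y\<in>?P. card {x :: 'a. x ^ d = y})" by (rule card_UN_le) simp
  also have "\<dots> \<le> (\<Sum>y\<in>?P. d)" by (intro sum_mono card_power_eq_le \<open>d > 0\<close>)
  finally have "d * e \<le> d * card ?P" by (simp add: mult.commute flip: de)
  with \<open>d > 0\<close> have "e \<le> card ?P" by simp
  moreover have "card ?P \<le> card ?R" using sub by (intro card_mono) auto
  moreover have "card ?R \<le> e" by (rule card_power_eq_le[OF \<open>e > 0\<close>])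
  ultimately show "?P = ?R" "card ?R = e" using sub card_subset_eq[of ?R ?P] by simp_all
qed

text \<open>Translation by 1 permutes the field, so summing over it shows that the characteristic
  divides \<open>p ^ i\<close> and hence equals \<open>p\<close>; the rest is iterated
  Frobenius.\<close>

lemma finite_field_power_prime_power_add:
  fixes x y :: "'a :: {finite, field}"
  assumes "prime p" and "CARD('a) = p ^ i"
  shows "(x + y) ^ (p ^ j) = x ^ (p ^ j) + y ^ (p ^ j)"
proof -
  have pr: "prime CHAR('a)"
    using prime_CHAR_semidom[where ?'a = 'a] finite_imp_CHAR_pos[where ?'a = 'a] by simp
  have "(\<Sum>z\<in>(UNIV :: 'a set). z + 1) = (\<Sum>z\<in>UNIV. z)"
    by (rule sum.reindex_bij_witness[of _ "\<lambda>z. z - 1" "\<lambda>z. z + 1"]) auto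
  then have "of_nat CARD('a) = (0 :: 'a)" by (simp add: sum.distrib)
  then have "CHAR('a) dvd p ^ i" by (simp only: of_nat_eq_0_iff_char_dvd assms)
  with pr assms have "CHAR('a) = p" by (metis prime_dvd_power primes_dvd_imp_eq)
  with pr show ?thesis by (intro freshmans_dream') auto
qed

section \<open>Lines over a subfield and sets invariant under its nonzero scalars\<close>

locale partial_spread =
  fixes F S :: "'a :: {finite, field} set" and n t :: nat
  assumes one_F: "1 \<in> F"
    and diff_F: "u \<in> F \<Longrightarrow> v \<in> F \<Longrightarrow> u - v \<in> F"
    and divide_F: "u \<in> F \<Longrightarrow> v \<in> F \<Longrightarrow> u / v \<in> F"
    and card_F: "card F = n"
    and card_field: "CARD('a) = n ^ 2"
    and zero_S: "0 \<notin> S"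
    and mult_S: "u \<in> F \<Longrightarrow> u \<noteq> 0 \<Longrightarrow> s \<in> S \<Longrightarrow> u * s \<in> S"
    and card_S: "card S = t * (n - 1)"
    and t_bounds: "0 < t" "t \<le> n"
begin

lemma zero_F: "0 \<in> F"
  using diff_F[OF one_F one_F] by simp

lemma uminus_F: "u \<in> F \<Longrightarrow> - u \<in> F"
  using diff_F[OF zero_F] by simp

lemma add_F: "u \<in> F \<Longrightarrow> v \<in> F \<Longrightarrow> u + v \<in> F"
  using diff_F[of u "- v"] uminus_F by simp

lemma inverse_F: "u \<in> F \<Longrightarrow> inverse u \<in> F"
  using divide_F[OF one_F] by (simp add: divide_inverse)

lemma mult_F: "u \<in> F \<Longrightarrow> v \<in> F \<Longrightarrow> u * v \<in> F"
  using divide_F[of u "inverse v"] inverse_F by (simp add: divide_inverse)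

lemma n_ge_2: "n \<ge> 2"
proof -
  have "card {0, 1 :: 'a} \<le> card F" using zero_F one_F by (intro card_mono) auto
  then show ?thesis by (simp add: card_F)
qed

lemma mult_S_iff: "u \<in> F \<Longrightarrow> u \<noteq> 0 \<Longrightarrow> u * s \<in> S \<longleftrightarrow> s \<in> S"
  using mult_S[of u s] mult_S[of "inverse u" "u * s"] inverse_F[of u]
  by (auto simp flip: mult.assoc)

lemma uminus_S_iff: "- s \<in> S \<longleftrightarrow> s \<in> S"
  using mult_S_iff[of "-1" s] uminus_F[OF one_F] by simp

definition line :: "'a \<Rightarrow> 'a set" where
  "line a = (\<lambda>u. u * a) ` F"

text \<open>The elements \<open>a\<close> and \<open>b\<close> are independent over
  \<open>F\<close>, which gives injectivity and avoidance of the line. Surjectivity follows by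
  counting: both sides have n(n - 1) elements.\<close>

lemma line_decomposition:
  assumes "a \<noteq> 0" and "b \<notin> line a"
  shows "bij_betw (\<lambda>(u, v). u * (b + v * a)) ((F - {0}) \<times> F) (UNIV - line a)"
proof -
  let ?f = "\<lambda>(u, v). u * (b + v * a)"
  have key: "u = u' \<and> v = v'"
    if *: "u \<in> F" "v \<in> F" "u' \<in> F" "v' \<in> F" "u \<noteq> 0" "u' \<noteq> 0"
      and eq: "u * (b + v * a) = u' * (b + v' * a)" for u v u' v'
  proof -
    have "u = u'"
    proof (rule ccontr)
      assume "u \<noteq> u'"
      with eq have "b = ((u' * v' - u * v) / (u - u')) * a"
        by (simp add: field_simps)
      moreover have "(u' * v' - u * v) / (u - u') \<in> F"
        using * by (intro divide_F diff_F mult_F)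
      ultimately show False using assms(2) unfolding line_def by blast
    qed
    with eq * assms(1) show ?thesis by simp
  qed
  have inj: "inj_on ?f ((F - {0}) \<times> F)"
  proof (rule inj_onI)
    fix x y assume "x \<in> (F - {0}) \<times> F" "y \<in> (F - {0}) \<times> F" "?f x = ?f y"
    then show "x = y" using key[of "fst x" "snd x" "fst y" "snd y"]
      by (cases x; cases y) simp
  qed
  have "u * (b + v * a) \<notin> line a" if *: "u \<in> F" "v \<in> F" "u \<noteq> 0" for u v
  proof
    assume "u * (b + v * a) \<in> line a"
    then obtain w where w: "w \<in> F" "u * (b + v * a) = w * a" by (auto simp: line_def)
    with * have "b = (w / u - v) * a" by (simp add: field_simps)
    moreover have "w / u - v \<in> F" using * w by (intro divide_F diff_F)
    ultimately show False using assms(2) unfolding line_def by blast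
  qed
  then have sub: "?f ` ((F - {0}) \<times> F) \<subseteq> UNIV - line a" by auto
  have "card (?f ` ((F - {0}) \<times> F)) = (n - 1) * n"
    using inj zero_F by (simp add: card_image card_cartesian_product card_F)
  moreover have "card (line a) = n"
    using assms(1) by (simp add: line_def card_image inj_on_def card_F)
  then have "card (UNIV - line a) = (n - 1) * n"
    by (simp add: card_Diff_subset card_field power2_eq_square algebra_simps)
  ultimately have "?f ` ((F - {0}) \<times> F) = UNIV - line a"
    using sub by (intro card_subset_eq) auto
  with inj show ?thesis by (simp add: bij_betw_def)
qed

text \<open>Membership of \<open>u * (b + v * a)\<close> in \<open>S\<close> depends on
  \<open>v\<close> alone, so the decomposition restricts to a product.\<close>

lemma card_translate_line_inter:
  assumes "a \<noteq> 0" and "b \<notin> line a"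
  shows "card (S - line a) = (n - 1) * card {v \<in> F. b + v * a \<in> S}"
proof -
  let ?f = "\<lambda>(u, v). u * (b + v * a)" and ?A = "(F - {0}) \<times> {v \<in> F. b + v * a \<in> S}"
  note bij = line_decomposition[OF assms]
  have "?f ` ?A = S - line a"
  proof
    show "?f ` ?A \<subseteq> S - line a"
      using bij_betw_imp_surj_on[OF bij] by (force simp: mult_S_iff)
    show "S - line a \<subseteq> ?f ` ?A"
    proof
      fix s assume s: "s \<in> S - line a"
      then have "s \<in> ?f ` ((F - {0}) \<times> F)" using bij_betw_imp_surj_on[OF bij] by simp
      then show "s \<in> ?f ` ?A" using s by (force simp: mult_S_iff)
    qed
  qed
  moreover have "inj_on ?f ?A"
    using bij by (auto simp: bij_betw_def intro: inj_on_subset)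
  ultimately have "card (S - line a) = card ?A" using card_image[of ?f ?A] by simp
  then show ?thesis using zero_F by (simp add: card_cartesian_product card_F)
qed

text \<open>Scaling a pair \<open>w\<close>, \<open>w + a\<close> by each nonzero \<open>u\<close>
  in \<open>F\<close> yields all pairs of points of \<open>S\<close> that differ by a nonzero
  multiple of \<open>a\<close>. This turns the count into one along lines parallel to
  \<open>line a\<close>.\<close>

lemma card_differences_scaled:
  "(n - 1) * card {w \<in> S. w + a \<in> S} = (\<Sum>w\<in>S. card {v \<in> F - {0}. w + v * a \<in> S})"
proof -
  have "bij_betw (\<lambda>(u, w). (u * w, u)) ((F - {0}) \<times> {w \<in> S. w + a \<in> S})
          (Sigma S (\<lambda>w. {v \<in> F - {0}. w + v * a \<in> S}))"
  proof (rule bij_betw_byWitness[where f' = "\<lambda>(w, v). (v, w / v)"])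
    show "(\<lambda>(u, w). (u * w, u)) ` ((F - {0}) \<times> {w \<in> S. w + a \<in> S})
            \<subseteq> Sigma S (\<lambda>w. {v \<in> F - {0}. w + v * a \<in> S})"
      by (auto simp: mult_S_iff mult_S_iff[of _ "_ + a", unfolded distrib_left])
    have "w / v + a \<in> S \<and> w / v \<in> S" if "w \<in> S" "v \<in> F" "v \<noteq> 0" "w + v * a \<in> S" for w v
      using that mult_S_iff[of v "w / v + a"] mult_S_iff[of v "w / v"] by (simp add: distrib_left)
    then show "(\<lambda>(w, v). (v, w / v)) ` (Sigma S (\<lambda>w. {v \<in> F - {0}. w + v * a \<in> S}))
            \<subseteq> (F - {0}) \<times> {w \<in> S. w + a \<in> S}" by auto
  qed auto
  then show ?thesis
    using zero_F by (auto dest!: bij_betw_same_card simp: card_cartesian_product card_F)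
qed

text \<open>The value \<open>v = 0\<close> gives \<open>w\<close> itself and always counts, so the
  natural subtraction is exact.\<close>

lemma card_punctured_translate:
  assumes "w \<in> S"
  shows "card {v \<in> F - {0}. w + v * a \<in> S} = card {v \<in> F. w + v * a \<in> S} - 1"
proof -
  have "{v \<in> F - {0}. w + v * a \<in> S} = {v \<in> F. w + v * a \<in> S} - {0}" by auto
  then show ?thesis using zero_F assms by simp
qed

text \<open>Here \<open>line a\<close> misses \<open>S\<close>, so each parallel through a point
  \<open>w\<close> of \<open>S\<close> carries \<open>t\<close> points of \<open>S\<close>, of which
  \<open>t - 1\<close> differ from \<open>w\<close>.\<close>

lemma card_differences_non_member:
  assumes "a \<noteq> 0" and "a \<notin> S"
  shows "card {w \<in> S. w + a \<in> S} = t * (t - 1)"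
proof -
  have "u * a \<notin> S" if "u \<in> F" for u
    using that assms zero_S by (cases "u = 0") (auto simp: mult_S_iff)
  then have disj: "S - line a = S" by (auto simp: line_def)
  have "card {v \<in> F - {0}. w + v * a \<in> S} = t - 1" if "w \<in> S" for w
  proof -
    have "w \<notin> line a" using that disj by auto
    from card_translate_line_inter[OF assms(1) this] have "card {v \<in> F. w + v * a \<in> S} = t"
      using n_ge_2 by (simp add: disj card_S)
    then show ?thesis using card_punctured_translate[OF that] by simp
  qed
  then have "(n - 1) * card {w \<in> S. w + a \<in> S} = (n - 1) * (t * (t - 1))"
    unfolding card_differences_scaled by (simp only: sum_constant card_S cong: sum.cong) simp
  then show ?thesis using n_ge_2 by simp
qed

text \<open>Here \<open>line a\<close> without 0 lies in \<open>S\<close>. Its n - 1 points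
  contribute n - 2 each, the other (n - 1)(t - 1) points of \<open>S\<close> contribute t - 2
  each.\<close>

lemma card_differences_member:
  assumes "a \<in> S"
  shows "card {w \<in> S. w + a \<in> S} = n - 2 + (t - 1) * (t - 2)"
proof -
  have a: "a \<noteq> 0" using assms zero_S by auto
  have inter: "S \<inter> line a = (\<lambda>u. u * a) ` (F - {0})"
    using assms zero_S by (auto simp: line_def mult_S_iff)
  have card_inter: "card (S \<inter> line a) = n - 1"
    unfolding inter using a zero_F by (simp add: card_image inj_on_def card_F)
  have "card S = card (S \<inter> line a) + card (S - line a)"
    by (rule card_Int_Diff) simp
  then have card_diff: "card (S - line a) = (n - 1) * (t - 1)"
    by (simp add: card_S card_inter algebra_simps)
  have off: "card {v \<in> F - {0}. w + v * a \<in> S} = t - 2" if "w \<in> S - line a" for w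
  proof -
    from card_translate_line_inter[OF a, of w] have "card {v \<in> F. w + v * a \<in> S} = t - 1"
      using n_ge_2 that by (simp add: card_diff)
    then show ?thesis using card_punctured_translate that by simp
  qed
  have on: "card {v \<in> F - {0}. w + v * a \<in> S} = n - 2" if w: "w \<in> S \<inter> line a" for w
  proof -
    from w obtain u where u: "u \<in> F" "u \<noteq> 0" "w = u * a" unfolding inter by auto
    \<comment> \<open>The point is (u + v)a, which leaves \<open>S\<close> only at the origin; with
      the excluded \<open>v = 0\<close> this removes two scalars.\<close>
    have "w + v * a \<in> S \<longleftrightarrow> v \<noteq> - u" if "v \<in> F" for v
      using mult_S_iff[of "u + v" a] add_F[OF u(1) that] assms zero_S
      by (auto simp: u(3) add_eq_0_iff simp flip: distrib_right)
    then have "{v \<in> F - {0}. w + v * a \<in> S} = F - {0, - u}" by auto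
    then show ?thesis using u zero_F uminus_F by (simp add: card_F card_Diff_subset)
  qed
  have "(n - 1) * card {w \<in> S. w + a \<in> S}
      = (\<Sum>w\<in>S \<inter> line a. card {v \<in> F - {0}. w + v * a \<in> S})
        + (\<Sum>w\<in>S - line a. card {v \<in> F - {0}. w + v * a \<in> S})"
    unfolding card_differences_scaled by (rule sum.Int_Diff) simp
  also have "\<dots> = (n - 1) * (n - 2 + (t - 1) * (t - 2))"
    by (simp only: sum_constant on off card_inter card_diff of_nat_id distrib_left mult.assoc
        cong: sum.cong)
  finally show ?thesis using n_ge_2 by simp
qed

section \<open>Parameters of the Cayley graph\<close>

lemma strongly_regular_cayley_graph:
  "strongly_regular (cayley_graph S)
     (n ^ 2) (t * (n - 1)) (n - 2 + (t - 1) * (t - 2)) (t * (t - 1))"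
proof -
  let ?G = "cayley_graph S"
  have arc: "x \<rightarrow>\<^bsub>?G\<^esub> y \<longleftrightarrow> y - x \<in> S" for x y
    by (simp add: cayley_graph_def)
  have sym: "x - y \<in> S \<longleftrightarrow> y - x \<in> S" for x y
    using uminus_S_iff[of "x - y"] by simp
  have graph: "pair_graph ?G"
    using zero_S
    by unfold_locales
      (auto simp: cayley_graph_def symmetric_def sym intro!: symI)
  \<comment> \<open>With w = z - x, the second adjacency, z - y in \<open>S\<close>, becomes w + (x
    - y) in \<open>S\<close>.\<close>
  have common: "card (common_neighbours ?G x y) = card {w \<in> S. w + (x - y) \<in> S}" for x y
    unfolding common_neighbours_def arc
    by (rule bij_betw_same_card[where f = "\<lambda>z. z - x"],
        rule bij_betw_byWitness[where f' = "\<lambda>w. w + x"])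
      (auto simp: cayley_graph_def algebra_simps)
  have valency: "card {y. y - x \<in> S} = t * (n - 1)" for x
  proof -
    have "{y. y - x \<in> S} = (\<lambda>s. s + x) ` S" by (force simp: image_iff)
    then show ?thesis by (simp add: card_image card_S)
  qed
  \<comment> \<open>The bound \<open>t \<le> n\<close> leaves out at least one direction; all n + 1
    of them would give the complete graph.\<close>
  have "t * (n - 1) < n ^ 2 - 1"
  proof -
    have "t * (n - 1) \<le> n * (n - 1)" using t_bounds by simp
    also have "\<dots> < (n + 1) * (n - 1)" using n_ge_2 by simp
    also have "\<dots> = n ^ 2 - 1" by (simp add: power2_eq_square algebra_simps)
    finally show ?thesis .
  qed
  moreover have "0 < t * (n - 1)" using t_bounds n_ge_2 by simp
  ultimately show ?thesis
    unfolding strongly_regular_def common arc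
    using graph card_differences_member card_differences_non_member valency
    by (auto simp: cayley_graph_def card_field sym)
qed

lemma latin_square_type_cayley_graph: "latin_square_type (cayley_graph S)"
proof -
  \<comment> \<open>For \<open>t = 1\<close> the natural number \<open>t - 2\<close> is 0 instead of
    -1, but the other factor vanishes.\<close>
  have "int ((t - 1) * (t - 2)) = (int t - 1) * (int t - 2)"
  proof (cases "t = 1")
    case False
    with t_bounds show ?thesis by simp
  qed simp
  then show ?thesis
    unfolding latin_square_type_def
    using strongly_regular_cayley_graph t_bounds n_ge_2
    by (intro exI conjI exI[of _ "int n"] exI[of _ "int t"]) (assumption, simp_all)
qed

end

section \<open>The group of powers with exponent q^l + 1\<close>

lemma Suc_dvd_odd_power_plus_1:
  fixes a :: nat
  assumes "odd r"
  shows "a + 1 dvd a ^ r + 1"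
proof -
  \<comment> \<open>Over the integers a + 1 is the difference a - (-1); odd \<open>r\<close> turns
    (-1)^r into -1.\<close>
  have "int a - (- 1) dvd int a ^ r - (- 1) ^ r" by (simp only: power_diff_sumr2 dvd_triv_left)
  then have "int (a + 1) dvd int (a ^ r + 1)" using assms by (simp add: ac_simps)
  then show ?thesis by (simp only: int_dvd_int_iff)
qed

theorem theorem5p4:
  fixes q m l :: nat
  assumes "primepow q"
    and "m \<ge> 1" and "l \<ge> 1"
    and "CARD('a :: {finite, field}) = q ^ m"
    and "l dvd m" and "even (m div l)" and "real l \<noteq> real m / 2"
    and "odd ((m div l) div 2)"
  shows "latin_square_type (Gamma q l :: 'a pair_pre_digraph)"
proof -
  obtain p i where p: "prime p" "q = p ^ i" using assms(1) by (auto simp: primepow_def)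
  define r where "r = m div l div 2"
  define n where "n = q ^ (l * r)"
  have m: "m = l * r * 2" using assms(5,6) by (auto simp: r_def)
  then have card: "CARD('a) = n ^ 2" by (simp add: assms(4) n_def power_mult)
  have "q ^ l + 1 dvd n + 1"
    unfolding n_def power_mult using assms(8) by (intro Suc_dvd_odd_power_plus_1) (simp add: r_def)
  then obtain t where t: "n + 1 = (q ^ l + 1) * t" by (rule dvdE)
  have "q > 0" using p by (simp add: prime_gt_0_nat)
  then have "n > 0" by (simp add: n_def)
  let ?F = "{x :: 'a. x ^ n = x}" and ?S = "connection_set q l :: 'a set"
  have card_minus_1: "n ^ 2 - 1 = (n + 1) * (n - 1)"
    by (simp add: power2_eq_square algebra_simps)
  \<comment> \<open>The group order is (n + 1)(n - 1) = (q^l + 1) t (n - 1). As roots of unity, the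
    elements of \<open>?S\<close> visibly stay in it under scaling by (n - 1)-th roots of
    unity.\<close>
  then have S: "?S = {y. y ^ (t * (n - 1)) = 1}" "card ?S = t * (n - 1)"
    using nonzero_powers_eq_roots_of_unity[where 'a = 'a, of "q ^ l + 1" "t * (n - 1)"]
    unfolding connection_set_def by (simp_all only: card t mult.assoc)
  have F_iff: "x ^ n = x \<longleftrightarrow> x = 0 \<or> x ^ (n - 1) = 1" for x :: 'a
    using \<open>n > 0\<close> by (cases n) auto
  have "CARD('a) > 1" by (rule one_less_card_field)
  then have "n > 1" using card \<open>n > 0\<close> by (cases "n = 1") auto
  have "partial_spread ?F ?S n t"
  proof
    show "u - v \<in> ?F" if "u \<in> ?F" "v \<in> ?F" for u v
    proof -
      \<comment> \<open>Additivity applied to (u - v) + v spares computing the sign (-1)^n.\<close>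
      have "(u - v + v) ^ n = (u - v) ^ n + v ^ n"
        unfolding n_def p(2) power_mult[symmetric]
        by (rule finite_field_power_prime_power_add[where i = "i * m"])
          (use assms(4) p in \<open>simp_all only: power_mult\<close>)
      then show ?thesis using that by (simp add: algebra_simps)
    qed
    have "?F = insert 0 {x. x ^ (n - 1) = 1}" by (auto simp: F_iff)
    moreover have "card {x :: 'a. x ^ (n - 1) = 1} = n - 1"
      using nonzero_powers_eq_roots_of_unity(2)[where 'a = 'a, of "n + 1" "n - 1"]
      by (simp only: card card_minus_1)
    ultimately show "card ?F = n" using \<open>n > 1\<close> by (simp add: power_0_left)
    have "t \<noteq> 0" using t by (auto intro: ccontr)
    then show "0 < t" by simp
    \<comment> \<open>This gives 2t \<le> n + 1, hence t \<le> n.\<close>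
    have "2 * t \<le> (q ^ l + 1) * t" using \<open>q > 0\<close> by (intro mult_right_mono) simp_all
    with t \<open>n > 1\<close> show "t \<le> n" by linarith
    show "0 \<notin> ?S" by (auto simp: connection_set_def)
    show "u * s \<in> ?S" if "u \<in> ?F" "u \<noteq> 0" "s \<in> ?S" for u s
    proof -
      have "u ^ (t * (n - 1)) = (u ^ (n - 1)) ^ t" by (simp add: mult.commute flip: power_mult)
      with that show ?thesis by (simp add: S F_iff power_mult_distrib)
    qed
  qed (use \<open>n > 0\<close> in \<open>simp_all only: card S(2) mem_Collect_eq power_divide power_one\<close>)
  then show ?thesis
    unfolding Gamma_def by (rule partial_spread.latin_square_type_cayley_graph)
qed

end
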